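(* Let $(\mathcal C,\otimes,I,\gamma)$ be a symmetric monoidal category, $(\mathcal T,\eta,\mu,\tau)$ a strong monad on it, and $\mathcal S$ a strong submonad of $\mathcal T$ with strong submonad monomorphism $\iota:\mathcal S\Rightarrow\mathcal T$. The following are equivalent: (1) for every object $X$, $(\mathcal SX,\iota_X)$ is a central cone of $\mathcal T$ at $X$; (2) the canonical embedding $\mathcal I:\mathcal C_{\mathcal S}\to\mathcal C_{\mathcal T}$ ($\mathcal I(X)=X$, $\mathcal I(f:X\to\mathcal SY)=\iota_Y\circ f$) corestricts to an embedding of categories $\hat{\mathcal I}:\mathcal C_{\mathcal S}\to Z(\mathcal C_{\mathcal T})$. Furthermore, these conditions imply that $\mathcal S$ is a commutative monad. If moreover $\mathcal T$ is centralisable, with centre $\mathcal Z$ and submonad monomorphism $\iota^{\mathcal Z}:\mathcal Z\Rightarrow\mathcal T$ given by terminal central cones, then (1) and (2) are also equivalent to: (3) $\mathcal S$ is a commutative submonad of $\mathcal Z$, i.e. $\mathcal S$ is commutative and there is a monomorphism of strong monads $j:\mathcal S\Rightarrow\mathcal Z$ with $\iota^{\mathcal Z}\circ j=\iota$.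
   Context: Right strength: $\tau'_{X,Y}=\mathcal T(\gamma_{Y,X})\circ\tau_{Y,X}\circ\gamma_{\mathcal TX,Y}$. Commutative strong monad: $\mu_{X\otimes Y}\circ\mathcal T\tau'_{X,Y}\circ\tau_{\mathcal TX,Y}=\mu_{X\otimes Y}\circ\mathcal T\tau_{X,Y}\circ\tau'_{X,\mathcal TY}$ for all $X,Y$. Morphism of strong monads $\iota:\mathcal S\Rightarrow\mathcal T$: natural transformation with $\iota\circ\eta^{\mathcal S}=\eta^{\mathcal T}$, $\iota\circ\mu^{\mathcal S}=\mu^{\mathcal T}\circ\mathcal T\iota\circ\iota_{\mathcal S}$, $\iota_{X\otimes Y}\circ\tau^{\mathcal S}_{X,Y}=\tau^{\mathcal T}_{X,Y}\circ(X\otimes\iota_Y)$; a strong submonad is given by a monomorphism in the category of strong monads. A central cone of $\mathcal T$ at $X$ is a pair $(Z,\kappa)$ with $\kappa:Z\to\mathcal TX$ such that for every object $Y$, $\mu_{X\otimes Y}\circ\mathcal T\tau'_{X,Y}\circ\tau_{\mathcal TX,Y}\circ(\kappa\otimes\mathrm{id}_{\mathcal TY})=\mu_{X\otimes Y}\circ\mathcal T\tau_{X,Y}\circ\tau'_{X,\mathcal TY}\circ(\kappa\otimes\mathrm{id}_{\mathcal TY})$; a terminal central cone is terminal among central cones at $X$ (morphisms $\varphi$ with $\kappa\circ\varphi=\kappa'$); $\mathcal T$ is centralisable if terminal central cones $(\mathcal ZX,\iota^{\mathcal Z}_X)$ exist at all $X$, and then $\mathcal Z$ carries a commutative strong monad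 structure making $\iota^{\mathcal Z}$ a strong submonad monomorphism (the centre of $\mathcal T$). Kleisli category: morphisms $X\to\mathcal TY$, composition $g\odot f=\mu\circ\mathcal Tg\circ f$. For $f:X\to\mathcal TY$ and object $W$: $f\otimes_l W=\tau'_{Y,W}\circ(f\otimes W)$, $W\otimes_r f=\tau_{W,Y}\circ(W\otimes f)$. A Kleisli morphism $f:X\to\mathcal TY$ is central if for all $f':X'\to\mathcal TY'$, $(Y\otimes_r f')\odot(f\otimes_l X')=(f\otimes_l Y')\odot(X\otimes_r f')$; $Z(\mathcal C_{\mathcal T})$ is the subcategory of all objects and central morphisms.
   Formalization: Every component ι_X is assumed monic in C: a monomorphism of strong monads need not have monic components, and otherwise the canonical functor I is not faithful, so (1) can hold while (2) fails. *)

theory Defs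
  imports Main
begin

record ('o, 'm) category =
  Obj :: "'o set"
  Arr :: "'m set"
  Dom :: "'m \<Rightarrow> 'o"
  Cod :: "'m \<Rightarrow> 'o"
  Ident :: "'o \<Rightarrow> 'm" (\<open>\<i>\<d>\<index>\<close>)
  Comp :: "'m \<Rightarrow> 'm \<Rightarrow> 'm" (infixr \<open>\<cdot>\<index>\<close> 65)

definition Hom :: "('o, 'm, 'z) category_scheme \<Rightarrow> 'o \<Rightarrow> 'o \<Rightarrow> 'm set" (\<open>Hom\<index>\<close>) where
  "Hom\<^bsub>C\<^esub> X Y = {f \<in> Arr C. Dom C f = X \<and> Cod C f = Y}"

locale category =
  fixes C :: "('o, 'm, 'z) category_scheme" (structure)
  assumes Dom_in_Obj: "f \<in> Arr C \<Longrightarrow> Dom C f \<in> Obj C"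
    and Cod_in_Obj: "f \<in> Arr C \<Longrightarrow> Cod C f \<in> Obj C"
    and Ident_in_Hom: "X \<in> Obj C \<Longrightarrow> \<i>\<d> X \<in> Hom X X"
    and Comp_in_Hom: "\<lbrakk>f \<in> Hom X Y; g \<in> Hom Y Z\<rbrakk> \<Longrightarrow> g \<cdot> f \<in> Hom X Z"
    and Comp_assoc: "\<lbrakk>f \<in> Hom W X; g \<in> Hom X Y; h \<in> Hom Y Z\<rbrakk> \<Longrightarrow> (h \<cdot> g) \<cdot> f = h \<cdot> (g \<cdot> f)"
    and Comp_Ident: "f \<in> Hom X Y \<Longrightarrow> f \<cdot> \<i>\<d> X = f"
    and Ident_Comp: "f \<in> Hom X Y \<Longrightarrow> \<i>\<d> Y \<cdot> f = f"

definition is_iso :: "('o, 'm, 'z) category_scheme \<Rightarrow> 'm \<Rightarrow> bool" where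
  "is_iso C f \<longleftrightarrow> (\<exists>g \<in> Hom\<^bsub>C\<^esub> (Cod C f) (Dom C f).
     g \<cdot>\<^bsub>C\<^esub> f = \<i>\<d>\<^bsub>C\<^esub> (Dom C f) \<and> f \<cdot>\<^bsub>C\<^esub> g = \<i>\<d>\<^bsub>C\<^esub> (Cod C f))"

definition monic :: "('o, 'm, 'z) category_scheme \<Rightarrow> 'm \<Rightarrow> bool" where
  "monic C m \<longleftrightarrow> (\<forall>W \<in> Obj C. \<forall>f \<in> Hom\<^bsub>C\<^esub> W (Dom C m). \<forall>g \<in> Hom\<^bsub>C\<^esub> W (Dom C m).
     m \<cdot>\<^bsub>C\<^esub> f = m \<cdot>\<^bsub>C\<^esub> g \<longrightarrow> f = g)"

locale cat_functor = A: category A + B: category B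
  for A :: "('o, 'm, 'z) category_scheme" and B :: "('p, 'n, 'y) category_scheme" +
  fixes Fo :: "'o \<Rightarrow> 'p" and Fa :: "'m \<Rightarrow> 'n"
  assumes Fo_in_Obj: "X \<in> Obj A \<Longrightarrow> Fo X \<in> Obj B"
    and Fa_in_Hom: "f \<in> Hom\<^bsub>A\<^esub> X Y \<Longrightarrow> Fa f \<in> Hom\<^bsub>B\<^esub> (Fo X) (Fo Y)"
    and Fa_Ident: "X \<in> Obj A \<Longrightarrow> Fa (\<i>\<d>\<^bsub>A\<^esub> X) = \<i>\<d>\<^bsub>B\<^esub> (Fo X)"
    and Fa_Comp: "\<lbrakk>f \<in> Hom\<^bsub>A\<^esub> X Y; g \<in> Hom\<^bsub>A\<^esub> Y Z\<rbrakk> \<Longrightarrow> Fa (g \<cdot>\<^bsub>A\<^esub> f) = Fa g \<cdot>\<^bsub>B\<^esub> Fa f"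

locale embedding = cat_functor +
  assumes faithful: "\<lbrakk>X \<in> Obj A; Y \<in> Obj A\<rbrakk> \<Longrightarrow> inj_on Fa (Hom\<^bsub>A\<^esub> X Y)"
    and inj_on_Obj: "inj_on Fo (Obj A)"

text \<open>\<open>\<boxtimes>\<close> is the tensor on objects, \<open>\<otimes>\<close> the tensor on morphisms.\<close>

record ('o, 'm) smcat = "('o, 'm) category" +
  tens_obj :: "'o \<Rightarrow> 'o \<Rightarrow> 'o" (infixr \<open>\<boxtimes>\<index>\<close> 70)
  tens_arr :: "'m \<Rightarrow> 'm \<Rightarrow> 'm" (infixr \<open>\<otimes>\<index>\<close> 70)
  unit_obj :: 'o (\<open>\<I>\<index>\<close>)
  associator :: "'o \<Rightarrow> 'o \<Rightarrow> 'o \<Rightarrow> 'm" (\<open>\<alpha>\<index>\<close>)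
  left_unitor :: "'o \<Rightarrow> 'm" (\<open>\<l>\<index>\<close>)
  right_unitor :: "'o \<Rightarrow> 'm" (\<open>\<r>\<index>\<close>)
  symmetry :: "'o \<Rightarrow> 'o \<Rightarrow> 'm" (\<open>\<gamma>\<index>\<close>)

locale symmetric_monoidal_category = category C
  for C :: "('o, 'm, 'z) smcat_scheme" (structure) +
  assumes tens_in_Obj: "\<lbrakk>X \<in> Obj C; Y \<in> Obj C\<rbrakk> \<Longrightarrow> X \<boxtimes> Y \<in> Obj C"
    and tens_in_Hom: "\<lbrakk>f \<in> Hom X X'; g \<in> Hom Y Y'\<rbrakk> \<Longrightarrow> f \<otimes> g \<in> Hom (X \<boxtimes> Y) (X' \<boxtimes> Y')"
    and tens_Ident: "\<lbrakk>X \<in> Obj C; Y \<in> Obj C\<rbrakk> \<Longrightarrow> \<i>\<d> X \<otimes> \<i>\<d> Y = \<i>\<d> (X \<boxtimes> Y)"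
    and tens_Comp: "\<lbrakk>f \<in> Hom X X'; f' \<in> Hom X' X''; g \<in> Hom Y Y'; g' \<in> Hom Y' Y''\<rbrakk>
        \<Longrightarrow> (f' \<cdot> f) \<otimes> (g' \<cdot> g) = (f' \<otimes> g') \<cdot> (f \<otimes> g)"
    and unit_in_Obj: "\<I> \<in> Obj C"
    and associator_in_Hom: "\<lbrakk>X \<in> Obj C; Y \<in> Obj C; Z \<in> Obj C\<rbrakk>
        \<Longrightarrow> \<alpha> X Y Z \<in> Hom ((X \<boxtimes> Y) \<boxtimes> Z) (X \<boxtimes> (Y \<boxtimes> Z))"
    and associator_iso: "\<lbrakk>X \<in> Obj C; Y \<in> Obj C; Z \<in> Obj C\<rbrakk> \<Longrightarrow> is_iso C (\<alpha> X Y Z)"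
    and associator_natural: "\<lbrakk>f \<in> Hom X X'; g \<in> Hom Y Y'; h \<in> Hom Z Z'\<rbrakk>
        \<Longrightarrow> \<alpha> X' Y' Z' \<cdot> ((f \<otimes> g) \<otimes> h) = (f \<otimes> (g \<otimes> h)) \<cdot> \<alpha> X Y Z"
    and left_unitor_in_Hom: "X \<in> Obj C \<Longrightarrow> \<l> X \<in> Hom (\<I> \<boxtimes> X) X"
    and left_unitor_iso: "X \<in> Obj C \<Longrightarrow> is_iso C (\<l> X)"
    and left_unitor_natural: "f \<in> Hom X Y \<Longrightarrow> \<l> Y \<cdot> (\<i>\<d> \<I> \<otimes> f) = f \<cdot> \<l> X"
    and right_unitor_in_Hom: "X \<in> Obj C \<Longrightarrow> \<r> X \<in> Hom (X \<boxtimes> \<I>) X"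
    and right_unitor_iso: "X \<in> Obj C \<Longrightarrow> is_iso C (\<r> X)"
    and right_unitor_natural: "f \<in> Hom X Y \<Longrightarrow> \<r> Y \<cdot> (f \<otimes> \<i>\<d> \<I>) = f \<cdot> \<r> X"
    and pentagon: "\<lbrakk>W \<in> Obj C; X \<in> Obj C; Y \<in> Obj C; Z \<in> Obj C\<rbrakk>
        \<Longrightarrow> (\<i>\<d> W \<otimes> \<alpha> X Y Z) \<cdot> \<alpha> W (X \<boxtimes> Y) Z \<cdot> (\<alpha> W X Y \<otimes> \<i>\<d> Z)
          = \<alpha> W X (Y \<boxtimes> Z) \<cdot> \<alpha> (W \<boxtimes> X) Y Z"
    and triangle: "\<lbrakk>X \<in> Obj C; Y \<in> Obj C\<rbrakk> \<Longrightarrow> (\<i>\<d> X \<otimes> \<l> Y) \<cdot> \<alpha> X \<I> Y = \<r> X \<otimes> \<i>\<d> Y"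
    and symmetry_in_Hom: "\<lbrakk>X \<in> Obj C; Y \<in> Obj C\<rbrakk> \<Longrightarrow> \<gamma> X Y \<in> Hom (X \<boxtimes> Y) (Y \<boxtimes> X)"
    and symmetry_natural: "\<lbrakk>f \<in> Hom X X'; g \<in> Hom Y Y'\<rbrakk> \<Longrightarrow> \<gamma> X' Y' \<cdot> (f \<otimes> g) = (g \<otimes> f) \<cdot> \<gamma> X Y"
    and symmetry_inverse: "\<lbrakk>X \<in> Obj C; Y \<in> Obj C\<rbrakk> \<Longrightarrow> \<gamma> Y X \<cdot> \<gamma> X Y = \<i>\<d> (X \<boxtimes> Y)"
    and hexagon: "\<lbrakk>X \<in> Obj C; Y \<in> Obj C; Z \<in> Obj C\<rbrakk>
        \<Longrightarrow> \<alpha> Y Z X \<cdot> \<gamma> X (Y \<boxtimes> Z) \<cdot> \<alpha> X Y Z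
          = (\<i>\<d> Y \<otimes> \<gamma> X Z) \<cdot> \<alpha> Y X Z \<cdot> (\<gamma> X Y \<otimes> \<i>\<d> Z)"

record ('o, 'm) strong_monad =
  FOb :: "'o \<Rightarrow> 'o"
  FAr :: "'m \<Rightarrow> 'm"
  eta :: "'o \<Rightarrow> 'm"
  mu :: "'o \<Rightarrow> 'm"
  tau :: "'o \<Rightarrow> 'o \<Rightarrow> 'm"

locale strong_monad =
  symmetric_monoidal_category C + endo: cat_functor C C "FOb T" "FAr T"
  for C :: "('o, 'm, 'z) smcat_scheme" (structure) and T :: "('o, 'm) strong_monad" +
  assumes eta_in_Hom: "X \<in> Obj C \<Longrightarrow> eta T X \<in> Hom X (FOb T X)"
    and eta_natural: "f \<in> Hom X Y \<Longrightarrow> eta T Y \<cdot> f = FAr T f \<cdot> eta T X"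
    and mu_in_Hom: "X \<in> Obj C \<Longrightarrow> mu T X \<in> Hom (FOb T (FOb T X)) (FOb T X)"
    and mu_natural: "f \<in> Hom X Y \<Longrightarrow> mu T Y \<cdot> FAr T (FAr T f) = FAr T f \<cdot> mu T X"
    and mu_assoc: "X \<in> Obj C \<Longrightarrow> mu T X \<cdot> FAr T (mu T X) = mu T X \<cdot> mu T (FOb T X)"
    and mu_eta: "X \<in> Obj C \<Longrightarrow> mu T X \<cdot> eta T (FOb T X) = \<i>\<d> (FOb T X)"
    and mu_map_eta: "X \<in> Obj C \<Longrightarrow> mu T X \<cdot> FAr T (eta T X) = \<i>\<d> (FOb T X)"
    and tau_in_Hom: "\<lbrakk>X \<in> Obj C; Y \<in> Obj C\<rbrakk>
        \<Longrightarrow> tau T X Y \<in> Hom (X \<boxtimes> FOb T Y) (FOb T (X \<boxtimes> Y))"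
    and tau_natural: "\<lbrakk>f \<in> Hom X X'; g \<in> Hom Y Y'\<rbrakk>
        \<Longrightarrow> tau T X' Y' \<cdot> (f \<otimes> FAr T g) = FAr T (f \<otimes> g) \<cdot> tau T X Y"
    and tau_unit: "X \<in> Obj C \<Longrightarrow> FAr T (\<l> X) \<cdot> tau T \<I> X = \<l> (FOb T X)"
    and tau_assoc: "\<lbrakk>X \<in> Obj C; Y \<in> Obj C; Z \<in> Obj C\<rbrakk>
        \<Longrightarrow> FAr T (\<alpha> X Y Z) \<cdot> tau T (X \<boxtimes> Y) Z
          = tau T X (Y \<boxtimes> Z) \<cdot> (\<i>\<d> X \<otimes> tau T Y Z) \<cdot> \<alpha> X Y (FOb T Z)"
    and tau_eta: "\<lbrakk>X \<in> Obj C; Y \<in> Obj C\<rbrakk> \<Longrightarrow> tau T X Y \<cdot> (\<i>\<d> X \<otimes> eta T Y) = eta T (X \<boxtimes> Y)"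
    and tau_mu: "\<lbrakk>X \<in> Obj C; Y \<in> Obj C\<rbrakk>
        \<Longrightarrow> tau T X Y \<cdot> (\<i>\<d> X \<otimes> mu T Y)
          = mu T (X \<boxtimes> Y) \<cdot> FAr T (tau T X Y) \<cdot> tau T X (FOb T Y)"

definition tau' ::
  "('o, 'm, 'z) smcat_scheme \<Rightarrow> ('o, 'm) strong_monad \<Rightarrow> 'o \<Rightarrow> 'o \<Rightarrow> 'm" where
  "tau' C T X Y = FAr T (\<gamma>\<^bsub>C\<^esub> Y X) \<cdot>\<^bsub>C\<^esub> tau T Y X \<cdot>\<^bsub>C\<^esub> \<gamma>\<^bsub>C\<^esub> (FOb T X) Y"

definition commutative_monad ::
  "('o, 'm, 'z) smcat_scheme \<Rightarrow> ('o, 'm) strong_monad \<Rightarrow> bool" where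
  "commutative_monad C T \<longleftrightarrow> strong_monad C T \<and> (\<forall>X \<in> Obj C. \<forall>Y \<in> Obj C.
     mu T (X \<boxtimes>\<^bsub>C\<^esub> Y) \<cdot>\<^bsub>C\<^esub> FAr T (tau' C T X Y) \<cdot>\<^bsub>C\<^esub> tau T (FOb T X) Y
   = mu T (X \<boxtimes>\<^bsub>C\<^esub> Y) \<cdot>\<^bsub>C\<^esub> FAr T (tau T X Y) \<cdot>\<^bsub>C\<^esub> tau' C T X (FOb T Y))"

locale strong_monad_morphism = S: strong_monad C S + T: strong_monad C T
  for C :: "('o, 'm, 'z) smcat_scheme" (structure)
    and S :: "('o, 'm) strong_monad" and T :: "('o, 'm) strong_monad" +
  fixes \<iota> :: "'o \<Rightarrow> 'm"
  assumes morphism_in_Hom: "X \<in> Obj C \<Longrightarrow> \<iota> X \<in> Hom (FOb S X) (FOb T X)"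
    and morphism_natural: "f \<in> Hom X Y \<Longrightarrow> \<iota> Y \<cdot> FAr S f = FAr T f \<cdot> \<iota> X"
    and morphism_eta: "X \<in> Obj C \<Longrightarrow> \<iota> X \<cdot> eta S X = eta T X"
    and morphism_mu: "X \<in> Obj C
        \<Longrightarrow> \<iota> X \<cdot> mu S X = mu T X \<cdot> FAr T (\<iota> X) \<cdot> \<iota> (FOb S X)"
    and morphism_tau: "\<lbrakk>X \<in> Obj C; Y \<in> Obj C\<rbrakk>
        \<Longrightarrow> \<iota> (X \<boxtimes> Y) \<cdot> tau S X Y = tau T X Y \<cdot> (\<i>\<d> X \<otimes> \<iota> Y)"

text \<open>
  A strong submonad is a monomorphism in the category of strong monads on \<open>C\<close>, whose
  morphisms are compared on the objects of \<open>C\<close> only.  When \<open>C\<close> lacks pullbacks this does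
  not force the components \<open>\<iota> X\<close> to be monic in \<open>C\<close>.  Since monicity of all components
  is exactly faithfulness of the canonical functor between the Kleisli categories, that
  functor is an embedding only if this is assumed in addition.
\<close>

definition strong_submonad :: "('o, 'm, 'z) smcat_scheme \<Rightarrow>
    ('o, 'm) strong_monad \<Rightarrow> ('o, 'm) strong_monad \<Rightarrow> ('o \<Rightarrow> 'm) \<Rightarrow> bool" where
  "strong_submonad C S T \<iota> \<longleftrightarrow> strong_monad_morphism C S T \<iota> \<and>
     (\<forall>R \<phi> \<psi>. strong_monad_morphism C R S \<phi> \<longrightarrow> strong_monad_morphism C R S \<psi> \<longrightarrow>
        (\<forall>X \<in> Obj C. \<iota> X \<cdot>\<^bsub>C\<^esub> \<phi> X = \<iota> X \<cdot>\<^bsub>C\<^esub> \<psi> X) \<longrightarrow> (\<forall>X \<in> Obj C. \<phi> X = \<psi> X))"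

definition central_cone :: "('o, 'm, 'z) smcat_scheme \<Rightarrow> ('o, 'm) strong_monad \<Rightarrow>
    'o \<Rightarrow> 'o \<times> 'm \<Rightarrow> bool" where
  "central_cone C T X = (\<lambda>(Z, \<kappa>). Z \<in> Obj C \<and> \<kappa> \<in> Hom\<^bsub>C\<^esub> Z (FOb T X) \<and> (\<forall>Y \<in> Obj C.
     mu T (X \<boxtimes>\<^bsub>C\<^esub> Y) \<cdot>\<^bsub>C\<^esub> FAr T (tau' C T X Y) \<cdot>\<^bsub>C\<^esub> tau T (FOb T X) Y
       \<cdot>\<^bsub>C\<^esub> (\<kappa> \<otimes>\<^bsub>C\<^esub> \<i>\<d>\<^bsub>C\<^esub> (FOb T Y))
   = mu T (X \<boxtimes>\<^bsub>C\<^esub> Y) \<cdot>\<^bsub>C\<^esub> FAr T (tau T X Y) \<cdot>\<^bsub>C\<^esub> tau' C T X (FOb T Y)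
       \<cdot>\<^bsub>C\<^esub> (\<kappa> \<otimes>\<^bsub>C\<^esub> \<i>\<d>\<^bsub>C\<^esub> (FOb T Y))))"

definition terminal_central_cone :: "('o, 'm, 'z) smcat_scheme \<Rightarrow> ('o, 'm) strong_monad \<Rightarrow>
    'o \<Rightarrow> 'o \<times> 'm \<Rightarrow> bool" where
  "terminal_central_cone C T X = (\<lambda>(Z, \<kappa>). central_cone C T X (Z, \<kappa>) \<and>
     (\<forall>Z' \<kappa>'. central_cone C T X (Z', \<kappa>') \<longrightarrow>
        (\<exists>!\<phi>. \<phi> \<in> Hom\<^bsub>C\<^esub> Z' Z \<and> \<kappa> \<cdot>\<^bsub>C\<^esub> \<phi> = \<kappa>')))"

definition centralisable ::
  "('o, 'm, 'z) smcat_scheme \<Rightarrow> ('o, 'm) strong_monad \<Rightarrow> bool" where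
  "centralisable C T \<longleftrightarrow> (\<forall>X \<in> Obj C. \<exists>c. terminal_central_cone C T X c)"

definition is_centre :: "('o, 'm, 'z) smcat_scheme \<Rightarrow>
    ('o, 'm) strong_monad \<Rightarrow> ('o, 'm) strong_monad \<Rightarrow> ('o \<Rightarrow> 'm) \<Rightarrow> bool" where
  "is_centre C T Z \<zeta> \<longleftrightarrow> commutative_monad C Z \<and> strong_submonad C Z T \<zeta> \<and>
     (\<forall>X \<in> Obj C. terminal_central_cone C T X (FOb Z X, \<zeta> X))"

text \<open>
  A Kleisli morphism from \<open>X\<close> to \<open>Y\<close> is represented by a triple \<open>(X, f, Y)\<close> with \<open>f\<close> a
  morphism from \<open>X\<close> to \<open>T Y\<close>, because \<open>Y\<close> cannot be recovered from \<open>f\<close> when \<open>T\<close> is not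
  injective on objects.
\<close>

type_synonym ('o, 'm) karr = "'o \<times> 'm \<times> 'o"

definition kleisli :: "('o, 'm, 'z) smcat_scheme \<Rightarrow> ('o, 'm) strong_monad \<Rightarrow>
    ('o, ('o, 'm) karr) category" where
  "kleisli C T = \<lparr>
     Obj = Obj C,
     Arr = {(X, f, Y). X \<in> Obj C \<and> Y \<in> Obj C \<and> f \<in> Hom\<^bsub>C\<^esub> X (FOb T Y)},
     Dom = (\<lambda>(X, f, Y). X),
     Cod = (\<lambda>(X, f, Y). Y),
     Ident = (\<lambda>X. (X, eta T X, X)),
     Comp = (\<lambda>(Y, g, Z) (X, f, _). (X, mu T Z \<cdot>\<^bsub>C\<^esub> FAr T g \<cdot>\<^bsub>C\<^esub> f, Z)) \<rparr>"

definition ltens :: "('o, 'm, 'z) smcat_scheme \<Rightarrow> ('o, 'm) strong_monad \<Rightarrow>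
    ('o, 'm) karr \<Rightarrow> 'o \<Rightarrow> ('o, 'm) karr" where
  "ltens C T = (\<lambda>(X, f, Y) W.
     (X \<boxtimes>\<^bsub>C\<^esub> W, tau' C T Y W \<cdot>\<^bsub>C\<^esub> (f \<otimes>\<^bsub>C\<^esub> \<i>\<d>\<^bsub>C\<^esub> W), Y \<boxtimes>\<^bsub>C\<^esub> W))"

definition rtens :: "('o, 'm, 'z) smcat_scheme \<Rightarrow> ('o, 'm) strong_monad \<Rightarrow>
    'o \<Rightarrow> ('o, 'm) karr \<Rightarrow> ('o, 'm) karr" where
  "rtens C T W = (\<lambda>(X, f, Y).
     (W \<boxtimes>\<^bsub>C\<^esub> X, tau T W Y \<cdot>\<^bsub>C\<^esub> (\<i>\<d>\<^bsub>C\<^esub> W \<otimes>\<^bsub>C\<^esub> f), W \<boxtimes>\<^bsub>C\<^esub> Y))"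

definition central_morphism :: "('o, 'm, 'z) smcat_scheme \<Rightarrow> ('o, 'm) strong_monad \<Rightarrow>
    ('o, 'm) karr \<Rightarrow> bool" where
  "central_morphism C T f \<longleftrightarrow> (let K = kleisli C T in f \<in> Arr K \<and> (\<forall>f' \<in> Arr K.
     rtens C T (Cod K f) f' \<cdot>\<^bsub>K\<^esub> ltens C T f (Dom K f')
   = ltens C T f (Cod K f') \<cdot>\<^bsub>K\<^esub> rtens C T (Dom K f) f'))"

definition kleisli_centre :: "('o, 'm, 'z) smcat_scheme \<Rightarrow> ('o, 'm) strong_monad \<Rightarrow>
    ('o, ('o, 'm) karr) category" where
  "kleisli_centre C T = (kleisli C T)\<lparr>Arr := {f. central_morphism C T f}\<rparr>"

definition kleisli_map :: "('o, 'm, 'z) smcat_scheme \<Rightarrow> ('o \<Rightarrow> 'm) \<Rightarrow>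
    ('o, 'm) karr \<Rightarrow> ('o, 'm) karr" where
  "kleisli_map C \<iota> = (\<lambda>(X, f, Y). (X, \<iota> Y \<cdot>\<^bsub>C\<^esub> f, Y))"

end

theory Submission
  imports Defs
begin

text \<open>
  A Kleisli morphism \<open>f\<close> from \<open>X\<close> to \<open>Y\<close> is central iff \<open>(X, f)\<close> is a central cone at \<open>Y\<close>,
  and central cones are closed under precomposition.  So if every \<open>\<iota> X\<close> is a central cone,
  then every \<open>\<iota> Y \<cdot> f\<close> is central; conversely the Kleisli morphism \<open>\<i>\<d> (S X)\<close> from \<open>S X\<close> to
  \<open>X\<close> is sent to \<open>\<iota> X\<close>.  Commutativity of \<open>S\<close> follows by composing both sides of its
  defining equation with the monic \<open>\<iota> (X \<boxtimes> Y)\<close>.  Finally, a terminal central cone is monic, so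
  the factorisations \<open>\<zeta> X \<cdot> j X = \<iota> X\<close> through the centre inherit all the laws of a strong
  monad morphism from \<open>\<iota>\<close> and \<open>\<zeta>\<close>.
\<close>

section \<open>Composition and monic arrows, in terms of domains and codomains\<close>

context category
begin

lemma Hom_iff: "f \<in> Hom X Y \<longleftrightarrow> f \<in> Arr C \<and> Dom C f = X \<and> Cod C f = Y"
  by (simp add: Hom_def)

lemma in_HomD:
  assumes "f \<in> Hom X Y"
  shows "f \<in> Arr C" "Dom C f = X" "Cod C f = Y" "X \<in> Obj C" "Y \<in> Obj C"
  using assms Dom_in_Obj Cod_in_Obj by (auto simp: Hom_iff)

lemma Arr_in_Hom: "f \<in> Arr C \<Longrightarrow> f \<in> Hom (Dom C f) (Cod C f)"
  by (simp add: Hom_iff)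

declare Dom_in_Obj [simp] Cod_in_Obj [simp]

lemma Ident_typing [simp]:
  assumes "X \<in> Obj C"
  shows "\<i>\<d> X \<in> Arr C" "Dom C (\<i>\<d> X) = X" "Cod C (\<i>\<d> X) = X"
  using Ident_in_Hom [OF assms] by (auto simp: Hom_iff)

lemma Comp_typing [simp]:
  assumes "f \<in> Arr C" "g \<in> Arr C" "Cod C f = Dom C g"
  shows "g \<cdot> f \<in> Arr C" "Dom C (g \<cdot> f) = Dom C f" "Cod C (g \<cdot> f) = Cod C g"
  using Comp_in_Hom [of f "Dom C f" "Dom C g" g "Cod C g"] assms by (auto simp: Hom_iff)

lemma Comp_assoc' [simp]:
  "\<lbrakk>f \<in> Arr C; g \<in> Arr C; h \<in> Arr C; Cod C f = Dom C g; Cod C g = Dom C h\<rbrakk>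
    \<Longrightarrow> (h \<cdot> g) \<cdot> f = h \<cdot> g \<cdot> f"
  using Comp_assoc [of f "Dom C f" "Dom C g" g "Dom C h" h "Cod C h"] by (simp add: Hom_iff)

lemma Comp_Ident' [simp]: "\<lbrakk>f \<in> Arr C; Dom C f = X\<rbrakk> \<Longrightarrow> f \<cdot> \<i>\<d> X = f"
  using Comp_Ident [OF Arr_in_Hom] by blast

lemma Ident_Comp' [simp]: "\<lbrakk>f \<in> Arr C; Cod C f = Y\<rbrakk> \<Longrightarrow> \<i>\<d> Y \<cdot> f = f"
  using Ident_Comp [OF Arr_in_Hom] by blast

text \<open>Composites are normalised to nest to the right, so an equation between
  \<open>a \<cdot> b\<close> and \<open>c\<close> does not match in front of a longer composite.
  This extends it by a tail \<open>x\<close>, and most of the rules ending in \<open>_left\<close>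
  are instances.\<close>

lemma Comp_cong_left:
  assumes "a \<cdot> b = c" "a \<in> Arr C" "b \<in> Arr C" "x \<in> Arr C" "Cod C b = Dom C a" "Cod C x = Dom C b"
  shows "a \<cdot> b \<cdot> x = c \<cdot> x"
  using assms Comp_assoc' [of x b a] by simp

lemma monicD:
  assumes "monic C m" "m \<cdot> f = m \<cdot> g" "f \<in> Arr C" "g \<in> Arr C"
    "Cod C f = Dom C m" "Cod C g = Dom C m" "Dom C f = Dom C g"
  shows "f = g"
  using assms unfolding monic_def by (metis Arr_in_Hom Dom_in_Obj)

end

section \<open>Interchange law and symmetry\<close>

context symmetric_monoidal_category
begin

declare tens_in_Obj [simp] tens_Ident [simp]

lemma tens_typing [simp]:
  assumes "f \<in> Arr C" "g \<in> Arr C"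
  shows "f \<otimes> g \<in> Arr C" "Dom C (f \<otimes> g) = Dom C f \<boxtimes> Dom C g"
    "Cod C (f \<otimes> g) = Cod C f \<boxtimes> Cod C g"
  using tens_in_Hom [OF Arr_in_Hom Arr_in_Hom, OF assms] by (auto simp: Hom_iff)

text \<open>Interchange is oriented to fuse adjacent tensors, so that different bracketings of the
  same factors reach one normal form.\<close>

lemma tens_Comp' [simp]:
  "\<lbrakk>f \<in> Arr C; f' \<in> Arr C; g \<in> Arr C; g' \<in> Arr C; Cod C f = Dom C f'; Cod C g = Dom C g'\<rbrakk>
    \<Longrightarrow> (f' \<otimes> g') \<cdot> (f \<otimes> g) = (f' \<cdot> f) \<otimes> (g' \<cdot> g)"
  by (rule tens_Comp [symmetric]) (auto simp: Hom_iff)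

lemma tens_Comp_left [simp]:
  "\<lbrakk>f \<in> Arr C; f' \<in> Arr C; g \<in> Arr C; g' \<in> Arr C; Cod C f = Dom C f'; Cod C g = Dom C g';
    h \<in> Arr C; Cod C h = Dom C f \<boxtimes> Dom C g\<rbrakk>
    \<Longrightarrow> (f' \<otimes> g') \<cdot> (f \<otimes> g) \<cdot> h = ((f' \<cdot> f) \<otimes> (g' \<cdot> g)) \<cdot> h"
  by (rule Comp_cong_left) auto

lemma symmetry_typing [simp]:
  assumes "X \<in> Obj C" "Y \<in> Obj C"
  shows "\<gamma> X Y \<in> Arr C" "Dom C (\<gamma> X Y) = X \<boxtimes> Y" "Cod C (\<gamma> X Y) = Y \<boxtimes> X"
  using symmetry_in_Hom [OF assms] by (auto simp: Hom_iff)

lemma symmetry_natural':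
  "\<lbrakk>f \<in> Arr C; g \<in> Arr C; Cod C f = X'; Cod C g = Y'\<rbrakk>
    \<Longrightarrow> \<gamma> X' Y' \<cdot> (f \<otimes> g) = (g \<otimes> f) \<cdot> \<gamma> (Dom C f) (Dom C g)"
  using symmetry_natural [OF Arr_in_Hom Arr_in_Hom] by blast

declare symmetry_inverse [simp]

end

section \<open>Naturality of the monad structure and laws of the right strength\<close>

context strong_monad
begin

declare endo.Fo_in_Obj [simp] endo.Fa_Ident [simp]

lemma FAr_typing [simp]:
  assumes "f \<in> Arr C"
  shows "FAr T f \<in> Arr C" "Dom C (FAr T f) = FOb T (Dom C f)" "Cod C (FAr T f) = FOb T (Cod C f)"
  using endo.Fa_in_Hom [OF Arr_in_Hom [OF assms]] by (auto simp: Hom_iff)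

lemma FAr_Comp [simp]:
  "\<lbrakk>f \<in> Arr C; g \<in> Arr C; Cod C f = Dom C g\<rbrakk> \<Longrightarrow> FAr T (g \<cdot> f) = FAr T g \<cdot> FAr T f"
  by (rule endo.Fa_Comp) (auto simp: Hom_iff)

lemma eta_typing [simp]:
  assumes "X \<in> Obj C"
  shows "eta T X \<in> Arr C" "Dom C (eta T X) = X" "Cod C (eta T X) = FOb T X"
  using eta_in_Hom [OF assms] by (auto simp: Hom_iff)

lemma mu_typing [simp]:
  assumes "X \<in> Obj C"
  shows "mu T X \<in> Arr C" "Dom C (mu T X) = FOb T (FOb T X)" "Cod C (mu T X) = FOb T X"
  using mu_in_Hom [OF assms] by (auto simp: Hom_iff)

lemma tau_typing [simp]:
  assumes "X \<in> Obj C" "Y \<in> Obj C"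
  shows "tau T X Y \<in> Arr C" "Dom C (tau T X Y) = X \<boxtimes> FOb T Y" "Cod C (tau T X Y) = FOb T (X \<boxtimes> Y)"
  using tau_in_Hom [OF assms] by (auto simp: Hom_iff)

lemma tau'_typing [simp]:
  assumes "X \<in> Obj C" "Y \<in> Obj C"
  shows "tau' C T X Y \<in> Arr C" "Dom C (tau' C T X Y) = FOb T X \<boxtimes> Y"
    "Cod C (tau' C T X Y) = FOb T (X \<boxtimes> Y)"
  using assms by (auto simp: tau'_def)

text \<open>This and the following naturality rules share an orientation: images under
  \<open>FAr T\<close> move to the right, so the structure maps \<open>eta\<close>,
  \<open>mu\<close>, \<open>tau\<close> gather on the left.\<close>

lemma FAr_eta [simp]:
  "\<lbrakk>f \<in> Arr C; Dom C f = X\<rbrakk> \<Longrightarrow> FAr T f \<cdot> eta T X = eta T (Cod C f) \<cdot> f"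
  using eta_natural [OF Arr_in_Hom] by metis

lemma FAr_mu [simp]:
  "\<lbrakk>f \<in> Arr C; Dom C f = X\<rbrakk> \<Longrightarrow> FAr T f \<cdot> mu T X = mu T (Cod C f) \<cdot> FAr T (FAr T f)"
  using mu_natural [OF Arr_in_Hom] by metis

lemma FAr_tau [simp]:
  "\<lbrakk>f \<in> Arr C; g \<in> Arr C; Dom C f = X; Dom C g = Y\<rbrakk>
    \<Longrightarrow> FAr T (f \<otimes> g) \<cdot> tau T X Y = tau T (Cod C f) (Cod C g) \<cdot> (f \<otimes> FAr T g)"
  using tau_natural [OF Arr_in_Hom Arr_in_Hom] by metis

lemma FAr_eta_left [simp]:
  "\<lbrakk>f \<in> Arr C; Dom C f = X; h \<in> Arr C; Cod C h = X\<rbrakk>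
    \<Longrightarrow> FAr T f \<cdot> eta T X \<cdot> h = eta T (Cod C f) \<cdot> f \<cdot> h"
  by (subst Comp_cong_left [OF FAr_eta]) auto

lemma FAr_mu_left [simp]:
  "\<lbrakk>f \<in> Arr C; Dom C f = X; h \<in> Arr C; Cod C h = FOb T (FOb T X)\<rbrakk>
    \<Longrightarrow> FAr T f \<cdot> mu T X \<cdot> h = mu T (Cod C f) \<cdot> FAr T (FAr T f) \<cdot> h"
  by (subst Comp_cong_left [OF FAr_mu]) auto

lemma FAr_tau_left [simp]:
  "\<lbrakk>f \<in> Arr C; g \<in> Arr C; Dom C f = X; Dom C g = Y; h \<in> Arr C; Cod C h = X \<boxtimes> FOb T Y\<rbrakk>
    \<Longrightarrow> FAr T (f \<otimes> g) \<cdot> tau T X Y \<cdot> h = tau T (Cod C f) (Cod C g) \<cdot> (f \<otimes> FAr T g) \<cdot> h"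
  by (subst Comp_cong_left [OF FAr_tau]) auto

lemma mu_mu_left:
  "\<lbrakk>X \<in> Obj C; h \<in> Arr C; Cod C h = FOb T (FOb T (FOb T X))\<rbrakk>
    \<Longrightarrow> mu T X \<cdot> mu T (FOb T X) \<cdot> h = mu T X \<cdot> FAr T (mu T X) \<cdot> h"
  by (subst Comp_cong_left [OF mu_assoc [symmetric]]) auto

lemma mu_eta_left:
  "\<lbrakk>X \<in> Obj C; h \<in> Arr C; Cod C h = FOb T X\<rbrakk> \<Longrightarrow> mu T X \<cdot> eta T (FOb T X) \<cdot> h = h"
  by (subst Comp_cong_left [OF mu_eta]) auto

lemma mu_map_eta_left:
  "\<lbrakk>X \<in> Obj C; h \<in> Arr C; Cod C h = FOb T X\<rbrakk> \<Longrightarrow> mu T X \<cdot> FAr T (eta T X) \<cdot> h = h"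
  by (subst Comp_cong_left [OF mu_map_eta]) auto

text \<open>In \<open>FAr T (tau' C T X Y) \<cdot> tau' C T (FOb T X) Y\<close> two symmetries meet
  under \<open>T\<close>; this cancels them.\<close>

lemma FAr_symmetry_inverse_left:
  assumes "X \<in> Obj C" "Y \<in> Obj C" "h \<in> Arr C" "Cod C h = FOb T (X \<boxtimes> Y)"
  shows "FAr T (\<gamma> Y X) \<cdot> FAr T (\<gamma> X Y) \<cdot> h = h"
proof -
  have "FAr T (\<gamma> Y X) \<cdot> FAr T (\<gamma> X Y) = \<i>\<d> (FOb T (X \<boxtimes> Y))"
    using assms FAr_Comp [of "\<gamma> X Y" "\<gamma> Y X"] by simp
  from Comp_cong_left [OF this] show ?thesis using assms by simp
qed

lemma FAr_tau' [simp]: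
  assumes "f \<in> Arr C" "g \<in> Arr C" "Dom C f = X" "Dom C g = Y"
  shows "FAr T (f \<otimes> g) \<cdot> tau' C T X Y = tau' C T (Cod C f) (Cod C g) \<cdot> (FAr T f \<otimes> g)"
proof -
  have obj: "X \<in> Obj C" "Y \<in> Obj C" "Cod C f \<in> Obj C" "Cod C g \<in> Obj C"
    using assms by auto
  \<comment> \<open>The outer symmetry of \<open>tau'\<close> sits under \<open>T\<close>, so its
    naturality square is needed in its image under \<open>FAr T\<close>.\<close>
  have "FAr T (f \<otimes> g) \<cdot> FAr T (\<gamma> Y X) = FAr T (\<gamma> (Cod C g) (Cod C f)) \<cdot> FAr T (g \<otimes> f)"
    using assms obj FAr_Comp [of "\<gamma> Y X" "f \<otimes> g"] FAr_Comp [of "g \<otimes> f" "\<gamma> (Cod C g) (Cod C f)"]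
    by (simp add: symmetry_natural')
  then have "FAr T (f \<otimes> g) \<cdot> FAr T (\<gamma> Y X) \<cdot> tau T Y X \<cdot> \<gamma> (FOb T X) Y =
      (FAr T (\<gamma> (Cod C g) (Cod C f)) \<cdot> FAr T (g \<otimes> f)) \<cdot> tau T Y X \<cdot> \<gamma> (FOb T X) Y"
    by (rule Comp_cong_left) (use assms obj in auto)
  then show ?thesis
    using assms obj by (simp add: tau'_def symmetry_natural')
qed

lemma FAr_tau'_left [simp]:
  "\<lbrakk>f \<in> Arr C; g \<in> Arr C; Dom C f = X; Dom C g = Y; h \<in> Arr C; Cod C h = FOb T X \<boxtimes> Y\<rbrakk>
    \<Longrightarrow> FAr T (f \<otimes> g) \<cdot> tau' C T X Y \<cdot> h = tau' C T (Cod C f) (Cod C g) \<cdot> (FAr T f \<otimes> g) \<cdot> h"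
  by (subst Comp_cong_left [OF FAr_tau']) auto

text \<open>This law and the next are \<open>tau_eta\<close> and \<open>tau_mu\<close> conjugated by
  the symmetry: its naturality exchanges the tensor factors before the law for \<open>tau\<close> is
  applied. They are what makes \<open>ltens\<close> respect Kleisli identities and
  composition.\<close>

lemma tau'_eta:
  assumes "X \<in> Obj C" "Y \<in> Obj C"
  shows "tau' C T X Y \<cdot> (eta T X \<otimes> \<i>\<d> Y) = eta T (X \<boxtimes> Y)"
proof -
  have "tau T Y X \<cdot> (\<i>\<d> Y \<otimes> eta T X) \<cdot> \<gamma> X Y = eta T (Y \<boxtimes> X) \<cdot> \<gamma> X Y"
    by (rule Comp_cong_left [OF tau_eta]) (use assms in auto)
  then show ?thesis
    using assms by (simp add: tau'_def symmetry_natural')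
qed

lemma tau'_mu:
  assumes "X \<in> Obj C" "Y \<in> Obj C"
  shows "tau' C T X Y \<cdot> (mu T X \<otimes> \<i>\<d> Y)
    = mu T (X \<boxtimes> Y) \<cdot> FAr T (tau' C T X Y) \<cdot> tau' C T (FOb T X) Y"
proof -
  have "tau T Y X \<cdot> (\<i>\<d> Y \<otimes> mu T X) \<cdot> \<gamma> (FOb T (FOb T X)) Y
      = (mu T (Y \<boxtimes> X) \<cdot> FAr T (tau T Y X) \<cdot> tau T Y (FOb T X)) \<cdot> \<gamma> (FOb T (FOb T X)) Y"
    by (rule Comp_cong_left [OF tau_mu]) (use assms in auto)
  then show ?thesis
    using assms by (simp add: tau'_def symmetry_natural' FAr_symmetry_inverse_left)
qed

lemma tau'_mu_left:
  "\<lbrakk>X \<in> Obj C; Y \<in> Obj C; h \<in> Arr C; Cod C h = FOb T (FOb T X) \<boxtimes> Y\<rbrakk>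
    \<Longrightarrow> tau' C T X Y \<cdot> (mu T X \<otimes> \<i>\<d> Y) \<cdot> h
      = mu T (X \<boxtimes> Y) \<cdot> FAr T (tau' C T X Y) \<cdot> tau' C T (FOb T X) Y \<cdot> h"
  by (subst Comp_cong_left [OF tau'_mu]) auto

section \<open>The Kleisli category\<close>

lemma kleisli_Hom_iff:
  "a \<in> Hom\<^bsub>kleisli C T\<^esub> X Y \<longleftrightarrow>
    (\<exists>f. a = (X, f, Y) \<and> X \<in> Obj C \<and> Y \<in> Obj C \<and> f \<in> Arr C \<and> Dom C f = X \<and> Cod C f = FOb T Y)"
  by (auto simp: Hom_def kleisli_def)

lemma kleisli_category: "category (kleisli C T)"
proof
  fix a W X b Y c Z
  assume "a \<in> Hom\<^bsub>kleisli C T\<^esub> W X" "b \<in> Hom\<^bsub>kleisli C T\<^esub> X Y" "c \<in> Hom\<^bsub>kleisli C T\<^esub> Y Z"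
  then show "(c \<cdot>\<^bsub>kleisli C T\<^esub> b) \<cdot>\<^bsub>kleisli C T\<^esub> a = c \<cdot>\<^bsub>kleisli C T\<^esub> (b \<cdot>\<^bsub>kleisli C T\<^esub> a)"
    by (auto simp: kleisli_Hom_iff) (auto simp: kleisli_def mu_mu_left)
next
  fix a X Y
  assume "a \<in> Hom\<^bsub>kleisli C T\<^esub> X Y"
  then show "a \<cdot>\<^bsub>kleisli C T\<^esub> \<i>\<d>\<^bsub>kleisli C T\<^esub> X = a" "\<i>\<d>\<^bsub>kleisli C T\<^esub> Y \<cdot>\<^bsub>kleisli C T\<^esub> a = a"
    by (auto simp: kleisli_Hom_iff) (auto simp: kleisli_def mu_eta_left mu_map_eta_left)
next
  fix a X Y b Z
  assume "a \<in> Hom\<^bsub>kleisli C T\<^esub> X Y" "b \<in> Hom\<^bsub>kleisli C T\<^esub> Y Z"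
  then show "b \<cdot>\<^bsub>kleisli C T\<^esub> a \<in> Hom\<^bsub>kleisli C T\<^esub> X Z"
    by (auto simp: kleisli_Hom_iff) (auto simp: kleisli_def)
qed (auto simp: kleisli_def Hom_def)

section \<open>Central cones and central Kleisli morphisms\<close>

lemma central_coneD:
  assumes "central_cone C T X (Z, \<kappa>)"
  shows "\<kappa> \<in> Arr C" "Dom C \<kappa> = Z" "Cod C \<kappa> = FOb T X" "Z \<in> Obj C"
  using assms in_HomD [of \<kappa>] by (auto simp: central_cone_def)

text \<open>Precomposing the cone equation with \<open>f \<otimes> g\<close> and fusing tensors
  frees both arguments. Varying \<open>f\<close> gives closure under precomposition; varying
  \<open>g\<close> gives centrality against arbitrary Kleisli morphisms, and commutativity of a
  submonad.\<close>

lemma central_cone_tens: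
  assumes cone: "central_cone C T X (Z, \<kappa>)" and X: "X \<in> Obj C" and Y: "Y \<in> Obj C"
    and f: "f \<in> Arr C" "Cod C f = Z" and g: "g \<in> Arr C" "Cod C g = FOb T Y"
  shows "mu T (X \<boxtimes> Y) \<cdot> FAr T (tau' C T X Y) \<cdot> tau T (FOb T X) Y \<cdot> ((\<kappa> \<cdot> f) \<otimes> g)
    = mu T (X \<boxtimes> Y) \<cdot> FAr T (tau T X Y) \<cdot> tau' C T X (FOb T Y) \<cdot> ((\<kappa> \<cdot> f) \<otimes> g)"
proof -
  note \<kappa> = central_coneD [OF cone]
  have "(mu T (X \<boxtimes> Y) \<cdot> FAr T (tau' C T X Y) \<cdot> tau T (FOb T X) Y \<cdot> (\<kappa> \<otimes> \<i>\<d> (FOb T Y))) \<cdot> (f \<otimes> g)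
      = (mu T (X \<boxtimes> Y) \<cdot> FAr T (tau T X Y) \<cdot> tau' C T X (FOb T Y) \<cdot> (\<kappa> \<otimes> \<i>\<d> (FOb T Y))) \<cdot> (f \<otimes> g)"
    using cone Y by (simp add: central_cone_def)
  then show ?thesis
    using \<kappa> X Y f g by simp
qed

lemma central_cone_Comp:
  assumes cone: "central_cone C T X (Z, \<kappa>)" and X: "X \<in> Obj C" and f: "f \<in> Hom W Z"
  shows "central_cone C T X (W, \<kappa> \<cdot> f)"
proof -
  note f' = in_HomD [OF f]
  show ?thesis
    using central_coneD [OF cone] f' X central_cone_tens [OF cone X _ f'(1,3)]
    by (simp add: central_cone_def Hom_iff)
qed

lemma terminal_central_cone_monic:
  assumes terminal: "terminal_central_cone C T X (Z, \<kappa>)" and X: "X \<in> Obj C"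
  shows "monic C \<kappa>"
  unfolding monic_def
proof (intro ballI impI)
  fix W f g
  assume f: "f \<in> Hom W (Dom C \<kappa>)" and g: "g \<in> Hom W (Dom C \<kappa>)" and eq: "\<kappa> \<cdot> f = \<kappa> \<cdot> g"
  have cone: "central_cone C T X (Z, \<kappa>)"
    using terminal by (simp add: terminal_central_cone_def)
  note Z = central_coneD(2) [OF cone]
  \<comment> \<open>Both \<open>f\<close> and \<open>g\<close> are cone morphisms from this cone to
    the terminal one, so uniqueness identifies them.\<close>
  have "central_cone C T X (W, \<kappa> \<cdot> g)"
    using central_cone_Comp [OF cone X] g Z by simp
  then have "\<exists>!\<phi>. \<phi> \<in> Hom W Z \<and> \<kappa> \<cdot> \<phi> = \<kappa> \<cdot> g"
    using terminal by (simp add: terminal_central_cone_def)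
  then show "f = g"
    using f g eq Z by metis
qed

text \<open>Taking \<open>f'\<close> to be the identity of \<open>T Y\<close>, seen as a Kleisli morphism from \<open>T Y\<close> to \<open>Y\<close>,
  recovers the central cone equation from centrality.\<close>

lemma central_morphism_iff:
  "central_morphism C T (X, f, Y) \<longleftrightarrow> Y \<in> Obj C \<and> central_cone C T Y (X, f)"
proof (intro iffI conjI)
  assume central: "central_morphism C T (X, f, Y)"
  then have types: "X \<in> Obj C" "Y \<in> Obj C" "f \<in> Arr C" "Dom C f = X" "Cod C f = FOb T Y"
    by (auto simp: central_morphism_def Let_def kleisli_def Hom_iff)
  then show "Y \<in> Obj C" by simp
  show "central_cone C T Y (X, f)"
  proof -
    have "mu T (Y \<boxtimes> W) \<cdot> FAr T (tau' C T Y W) \<cdot> tau T (FOb T Y) W \<cdot> (f \<otimes> \<i>\<d> (FOb T W))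
        = mu T (Y \<boxtimes> W) \<cdot> FAr T (tau T Y W) \<cdot> tau' C T Y (FOb T W) \<cdot> (f \<otimes> \<i>\<d> (FOb T W))"
      if W: "W \<in> Obj C" for W
    proof -
      have "(FOb T W, \<i>\<d> (FOb T W), W) \<in> Arr (kleisli C T)"
        using W by (simp add: kleisli_def Hom_iff)
      with central have "rtens C T Y (FOb T W, \<i>\<d> (FOb T W), W)
          \<cdot>\<^bsub>kleisli C T\<^esub> ltens C T (X, f, Y) (FOb T W)
        = ltens C T (X, f, Y) W \<cdot>\<^bsub>kleisli C T\<^esub> rtens C T X (FOb T W, \<i>\<d> (FOb T W), W)"
        by (force simp: central_morphism_def Let_def kleisli_def)
      then show ?thesis
        using W types by (simp add: kleisli_def rtens_def ltens_def)
    qed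
    then show ?thesis
      using types by (simp add: central_cone_def Hom_iff)
  qed
next
  assume *: "Y \<in> Obj C \<and> central_cone C T Y (X, f)"
  then have cone: "central_cone C T Y (X, f)" and Y: "Y \<in> Obj C" by auto
  note f = central_coneD [OF cone]
  have "rtens C T Y (X', f', Y') \<cdot>\<^bsub>kleisli C T\<^esub> ltens C T (X, f, Y) X'
      = ltens C T (X, f, Y) Y' \<cdot>\<^bsub>kleisli C T\<^esub> rtens C T X (X', f', Y')"
    if "X' \<in> Obj C" "Y' \<in> Obj C" "f' \<in> Arr C" "Dom C f' = X'" "Cod C f' = FOb T Y'" for X' f' Y'
    \<comment> \<open>By naturality of \<open>tau\<close> and \<open>tau'\<close>, the two Kleisli
      composites become the two sides of the cone equation, both precomposed with
      \<open>f \<otimes> f'\<close>.\<close>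
    using central_cone_tens [OF cone Y, of Y' "\<i>\<d> X" f'] that f Y
    by (simp add: kleisli_def rtens_def ltens_def)
  then show "central_morphism C T (X, f, Y)"
    using f Y by (auto simp: central_morphism_def Let_def kleisli_def Hom_iff)
qed

section \<open>The central morphisms form a category\<close>

lemma ltens_Ident:
  "\<lbrakk>X \<in> Obj C; W \<in> Obj C\<rbrakk> \<Longrightarrow> ltens C T (X, eta T X, X) W = (X \<boxtimes> W, eta T (X \<boxtimes> W), X \<boxtimes> W)"
  by (simp add: ltens_def tau'_eta)

lemma ltens_Comp:
  assumes "a \<in> Hom\<^bsub>kleisli C T\<^esub> X Y" "b \<in> Hom\<^bsub>kleisli C T\<^esub> Y Z" "W \<in> Obj C"
  shows "ltens C T (b \<cdot>\<^bsub>kleisli C T\<^esub> a) W = ltens C T b W \<cdot>\<^bsub>kleisli C T\<^esub> ltens C T a W"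
proof -
  obtain f g where ab: "a = (X, f, Y)" "b = (Y, g, Z)"
    and types: "X \<in> Obj C" "Y \<in> Obj C" "Z \<in> Obj C" "f \<in> Arr C" "Dom C f = X" "Cod C f = FOb T Y"
      "g \<in> Arr C" "Dom C g = Y" "Cod C g = FOb T Z"
    using assms by (auto simp: kleisli_Hom_iff)
  \<comment> \<open>Splitting off \<open>mu T Z \<otimes> \<i>\<d> W\<close> exposes the left-hand
    side of \<open>tau'_mu\<close>. The fusing rules stay disabled until that law has been applied,
    since they would undo the splitting.\<close>
  have "(mu T Z \<cdot> FAr T g \<cdot> f) \<otimes> \<i>\<d> W = (mu T Z \<otimes> \<i>\<d> W) \<cdot> ((FAr T g \<cdot> f) \<otimes> \<i>\<d> W)"
    using types assms(3) by simp
  then show ?thesis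
    using types assms(3) by (simp add: ab kleisli_def ltens_def tau'_mu_left
        del: tens_Comp' tens_Comp_left) simp
qed

lemma ltens_in_Hom:
  "\<lbrakk>a \<in> Hom\<^bsub>kleisli C T\<^esub> X Y; W \<in> Obj C\<rbrakk> \<Longrightarrow> ltens C T a W \<in> Hom\<^bsub>kleisli C T\<^esub> (X \<boxtimes> W) (Y \<boxtimes> W)"
  by (auto simp: kleisli_Hom_iff ltens_def)

lemma rtens_in_Hom:
  "\<lbrakk>a \<in> Hom\<^bsub>kleisli C T\<^esub> X Y; W \<in> Obj C\<rbrakk> \<Longrightarrow> rtens C T W a \<in> Hom\<^bsub>kleisli C T\<^esub> (W \<boxtimes> X) (W \<boxtimes> Y)"
  by (auto simp: kleisli_Hom_iff rtens_def)

lemma central_morphism_Hom_iff: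
  assumes "a \<in> Hom\<^bsub>kleisli C T\<^esub> X Y"
  shows "central_morphism C T a \<longleftrightarrow> (\<forall>X' Y' b. b \<in> Hom\<^bsub>kleisli C T\<^esub> X' Y' \<longrightarrow>
    rtens C T Y b \<cdot>\<^bsub>kleisli C T\<^esub> ltens C T a X' = ltens C T a Y' \<cdot>\<^bsub>kleisli C T\<^esub> rtens C T X b)"
  using assms by (auto simp: central_morphism_def Let_def Hom_def)

text \<open>By \<open>ltens_Ident\<close>, tensoring an identity gives a Kleisli identity, so both
  composites reduce to \<open>rtens C T X b\<close>.\<close>

lemma central_morphism_Ident:
  assumes X: "X \<in> Obj C"
  shows "central_morphism C T (X, eta T X, X)"
proof -
  interpret K: category "kleisli C T" by (rule kleisli_category)
  have id: "\<i>\<d>\<^bsub>kleisli C T\<^esub> U = (U, eta T U, U)" for U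
    by (simp add: kleisli_def)
  have "(X, eta T X, X) \<in> Hom\<^bsub>kleisli C T\<^esub> X X"
    using X by (simp add: kleisli_Hom_iff)
  moreover have "rtens C T X b \<cdot>\<^bsub>kleisli C T\<^esub> ltens C T (X, eta T X, X) X'
      = ltens C T (X, eta T X, X) Y' \<cdot>\<^bsub>kleisli C T\<^esub> rtens C T X b"
    if b: "b \<in> Hom\<^bsub>kleisli C T\<^esub> X' Y'" for b X' Y'
  proof -
    have "X' \<in> Obj C" "Y' \<in> Obj C"
      using b by (auto simp: kleisli_Hom_iff)
    then show ?thesis
      using K.Comp_Ident K.Ident_Comp rtens_in_Hom [OF b X] X
      by (simp add: ltens_Ident id)
  qed
  ultimately show ?thesis
    by (simp add: central_morphism_Hom_iff)
qed

text \<open>As \<open>ltens\<close> respects composition, the test morphism \<open>c\<close> can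
  slide past \<open>b\<close> first and then past \<open>a\<close>.\<close>

lemma central_morphism_Comp:
  assumes a: "a \<in> Hom\<^bsub>kleisli C T\<^esub> X Y" and b: "b \<in> Hom\<^bsub>kleisli C T\<^esub> Y Z"
    and central: "central_morphism C T a" "central_morphism C T b"
  shows "central_morphism C T (b \<cdot>\<^bsub>kleisli C T\<^esub> a)"
proof -
  interpret K: category "kleisli C T" by (rule kleisli_category)
  have obj: "X \<in> Obj C" "Y \<in> Obj C" "Z \<in> Obj C"
    using a b by (auto simp: kleisli_Hom_iff)
  have "rtens C T Z c \<cdot>\<^bsub>kleisli C T\<^esub> ltens C T (b \<cdot>\<^bsub>kleisli C T\<^esub> a) U
      = ltens C T (b \<cdot>\<^bsub>kleisli C T\<^esub> a) V \<cdot>\<^bsub>kleisli C T\<^esub> rtens C T X c"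
    if c: "c \<in> Hom\<^bsub>kleisli C T\<^esub> U V" for c U V
  proof -
    have UV: "U \<in> Obj C" "V \<in> Obj C"
      using c by (auto simp: kleisli_Hom_iff)
    note l = ltens_in_Hom [OF a UV(1)] ltens_in_Hom [OF a UV(2)]
      ltens_in_Hom [OF b UV(1)] ltens_in_Hom [OF b UV(2)]
    note r = rtens_in_Hom [OF c obj(1)] rtens_in_Hom [OF c obj(2)] rtens_in_Hom [OF c obj(3)]
    have "rtens C T Z c \<cdot>\<^bsub>kleisli C T\<^esub> ltens C T (b \<cdot>\<^bsub>kleisli C T\<^esub> a) U
        = (rtens C T Z c \<cdot>\<^bsub>kleisli C T\<^esub> ltens C T b U) \<cdot>\<^bsub>kleisli C T\<^esub> ltens C T a U"
      by (simp add: ltens_Comp [OF a b UV(1)] K.Comp_assoc [OF l(1) l(3) r(3)])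
    also have "\<dots> = (ltens C T b V \<cdot>\<^bsub>kleisli C T\<^esub> rtens C T Y c) \<cdot>\<^bsub>kleisli C T\<^esub> ltens C T a U"
      using central(2) [unfolded central_morphism_Hom_iff [OF b]] c by metis
    also have "\<dots> = ltens C T b V \<cdot>\<^bsub>kleisli C T\<^esub> (rtens C T Y c \<cdot>\<^bsub>kleisli C T\<^esub> ltens C T a U)"
      by (rule K.Comp_assoc [OF l(1) r(2) l(4)])
    also have "\<dots> = ltens C T b V \<cdot>\<^bsub>kleisli C T\<^esub> (ltens C T a V \<cdot>\<^bsub>kleisli C T\<^esub> rtens C T X c)"
      using central(1) [unfolded central_morphism_Hom_iff [OF a]] c by metis
    also have "\<dots> = ltens C T (b \<cdot>\<^bsub>kleisli C T\<^esub> a) V \<cdot>\<^bsub>kleisli C T\<^esub> rtens C T X c"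
      by (simp add: ltens_Comp [OF a b UV(2)] K.Comp_assoc [OF r(1) l(2) l(4)])
    finally show ?thesis .
  qed
  then show ?thesis
    by (simp add: central_morphism_Hom_iff [OF K.Comp_in_Hom [OF a b]])
qed

lemma kleisli_centre_Hom_iff:
  "a \<in> Hom\<^bsub>kleisli_centre C T\<^esub> X Y \<longleftrightarrow> a \<in> Hom\<^bsub>kleisli C T\<^esub> X Y \<and> central_morphism C T a"
  by (auto simp: kleisli_centre_def Hom_def central_morphism_def Let_def)

lemma kleisli_centre_simps:
  "Obj (kleisli_centre C T) = Obj C" "Ident (kleisli_centre C T) X = (X, eta T X, X)"
  "Comp (kleisli_centre C T) = Comp (kleisli C T)"
  by (simp_all add: kleisli_centre_def kleisli_def)

text \<open>The locale \<open>embedding\<close> demands that its target be a category, so this is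
  part of condition (2).\<close>

lemma kleisli_centre_category: "category (kleisli_centre C T)"
proof -
  interpret K: category "kleisli C T" by (rule kleisli_category)
  have id: "(X, eta T X, X) = \<i>\<d>\<^bsub>kleisli C T\<^esub> X" for X
    by (simp add: kleisli_def)
  have obj: "Obj (kleisli C T) = Obj C"
    by (simp add: kleisli_def)
  show ?thesis
  proof
    fix a
    assume "a \<in> Arr (kleisli_centre C T)"
    then have "a \<in> Arr (kleisli C T)"
      by (simp add: kleisli_centre_def central_morphism_def Let_def)
    then show "Dom (kleisli_centre C T) a \<in> Obj (kleisli_centre C T)"
      "Cod (kleisli_centre C T) a \<in> Obj (kleisli_centre C T)"
      using K.Dom_in_Obj K.Cod_in_Obj by (simp_all add: kleisli_centre_def)
  next
    fix X
    assume "X \<in> Obj (kleisli_centre C T)"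
    then show "\<i>\<d>\<^bsub>kleisli_centre C T\<^esub> X \<in> Hom\<^bsub>kleisli_centre C T\<^esub> X X"
      by (simp add: kleisli_centre_Hom_iff kleisli_centre_simps central_morphism_Ident kleisli_Hom_iff)
  qed (auto simp: kleisli_centre_Hom_iff kleisli_centre_simps id obj K.Comp_Ident K.Ident_Comp
        intro: K.Comp_in_Hom K.Comp_assoc central_morphism_Comp)
qed

end

section \<open>Submonads whose components are central cones\<close>

context strong_monad_morphism
begin

lemma morphism_typing [simp]:
  assumes "X \<in> Obj C"
  shows "\<iota> X \<in> Arr C" "Dom C (\<iota> X) = FOb S X" "Cod C (\<iota> X) = FOb T X"
  using morphism_in_Hom [OF assms] by (auto simp: S.Hom_iff)

text \<open>Here and in the rules below, \<open>\<iota>\<close> moves to the right and turns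
  structure of \<open>S\<close> into structure of \<open>T\<close>. A composite in \<open>S\<close>
  preceded by \<open>\<iota>\<close> thus becomes one in \<open>T\<close> applied to components of
  \<open>\<iota>\<close>.\<close>

lemma morphism_natural' [simp]:
  "\<lbrakk>f \<in> Arr C; Cod C f = Y\<rbrakk> \<Longrightarrow> \<iota> Y \<cdot> FAr S f = FAr T f \<cdot> \<iota> (Dom C f)"
  using morphism_natural [OF S.Arr_in_Hom] by blast

lemma morphism_natural_left [simp]:
  "\<lbrakk>f \<in> Arr C; Cod C f = Y; h \<in> Arr C; Cod C h = FOb S (Dom C f)\<rbrakk>
    \<Longrightarrow> \<iota> Y \<cdot> FAr S f \<cdot> h = FAr T f \<cdot> \<iota> (Dom C f) \<cdot> h"
  by (subst S.Comp_cong_left [OF morphism_natural']) auto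

lemma morphism_mu_left:
  "\<lbrakk>X \<in> Obj C; h \<in> Arr C; Cod C h = FOb S (FOb S X)\<rbrakk>
    \<Longrightarrow> \<iota> X \<cdot> mu S X \<cdot> h = mu T X \<cdot> FAr T (\<iota> X) \<cdot> \<iota> (FOb S X) \<cdot> h"
  by (subst S.Comp_cong_left [OF morphism_mu]) auto

lemma morphism_tau_left:
  "\<lbrakk>X \<in> Obj C; Y \<in> Obj C; h \<in> Arr C; Cod C h = X \<boxtimes> FOb S Y\<rbrakk>
    \<Longrightarrow> \<iota> (X \<boxtimes> Y) \<cdot> tau S X Y \<cdot> h = tau T X Y \<cdot> (\<i>\<d> X \<otimes> \<iota> Y) \<cdot> h"
  by (subst S.Comp_cong_left [OF morphism_tau]) auto

lemma morphism_tau':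
  "\<lbrakk>X \<in> Obj C; Y \<in> Obj C\<rbrakk> \<Longrightarrow> \<iota> (X \<boxtimes> Y) \<cdot> tau' C S X Y = tau' C T X Y \<cdot> (\<iota> X \<otimes> \<i>\<d> Y)"
  by (simp add: tau'_def morphism_tau_left S.symmetry_natural')

text \<open>Rewriting with \<open>morphism_mu\<close> leaves a component of \<open>\<iota>\<close>
  under \<open>FAr T\<close>, so compatibility with the strength is also needed under
  \<open>T\<close>.\<close>

lemma FAr_morphism_tau:
  assumes "X \<in> Obj C" "Y \<in> Obj C" "h \<in> Arr C" "Cod C h = FOb T (X \<boxtimes> FOb S Y)"
  shows "FAr T (\<iota> (X \<boxtimes> Y)) \<cdot> FAr T (tau S X Y) \<cdot> h
    = FAr T (tau T X Y) \<cdot> FAr T (\<i>\<d> X \<otimes> \<iota> Y) \<cdot> h"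
proof -
  have "FAr T (\<iota> (X \<boxtimes> Y)) \<cdot> FAr T (tau S X Y) = FAr T (tau T X Y) \<cdot> FAr T (\<i>\<d> X \<otimes> \<iota> Y)"
    using assms arg_cong [OF morphism_tau, of X Y "FAr T"] by simp
  from S.Comp_cong_left [OF this] show ?thesis using assms by simp
qed

lemma FAr_morphism_tau':
  assumes "X \<in> Obj C" "Y \<in> Obj C" "h \<in> Arr C" "Cod C h = FOb T (FOb S X \<boxtimes> Y)"
  shows "FAr T (\<iota> (X \<boxtimes> Y)) \<cdot> FAr T (tau' C S X Y) \<cdot> h
    = FAr T (tau' C T X Y) \<cdot> FAr T (\<iota> X \<otimes> \<i>\<d> Y) \<cdot> h"
proof -
  have "FAr T (\<iota> (X \<boxtimes> Y)) \<cdot> FAr T (tau' C S X Y) = FAr T (tau' C T X Y) \<cdot> FAr T (\<iota> X \<otimes> \<i>\<d> Y)"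
    using assms arg_cong [OF morphism_tau', of X Y "FAr T"] by simp
  from S.Comp_cong_left [OF this] show ?thesis using assms by simp
qed

lemma commutative_if_central_cones:
  assumes monic: "\<forall>X \<in> Obj C. monic C (\<iota> X)"
    and cone: "\<forall>X \<in> Obj C. central_cone C T X (FOb S X, \<iota> X)"
  shows "commutative_monad C S"
  unfolding commutative_monad_def
proof (intro conjI ballI)
  show "strong_monad C S" ..
  fix X Y assume XY: "X \<in> Obj C" "Y \<in> Obj C"
  let ?l = "mu S (X \<boxtimes> Y) \<cdot> FAr S (tau' C S X Y) \<cdot> tau S (FOb S X) Y"
  let ?r = "mu S (X \<boxtimes> Y) \<cdot> FAr S (tau S X Y) \<cdot> tau' C S X (FOb S Y)"
  have "\<iota> (X \<boxtimes> Y) \<cdot> ?l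
      = mu T (X \<boxtimes> Y) \<cdot> FAr T (tau' C T X Y) \<cdot> tau T (FOb T X) Y \<cdot> (\<iota> X \<otimes> \<iota> Y)"
    using XY by (simp add: morphism_mu_left morphism_tau_left morphism_tau FAr_morphism_tau')
  \<comment> \<open>Centrality of the cone \<open>\<iota> X\<close>, tested against
    \<open>\<iota> Y\<close> in the second factor.\<close>
  also have "\<dots> = mu T (X \<boxtimes> Y) \<cdot> FAr T (tau T X Y) \<cdot> tau' C T X (FOb T Y) \<cdot> (\<iota> X \<otimes> \<iota> Y)"
    using T.central_cone_tens [of X "FOb S X" "\<iota> X" Y "\<i>\<d> (FOb S X)" "\<iota> Y"] cone XY by simp
  also have "\<dots> = \<iota> (X \<boxtimes> Y) \<cdot> ?r"
    using XY by (simp add: morphism_mu_left morphism_tau' FAr_morphism_tau)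
  finally show "?l = ?r"
    by (rule S.monicD [rotated]) (use monic XY in auto)
qed

lemma embedding_iff_central_cones:
  assumes monic: "\<forall>X \<in> Obj C. monic C (\<iota> X)"
  shows "embedding (kleisli C S) (kleisli_centre C T) (\<lambda>X. X) (kleisli_map C \<iota>)
    \<longleftrightarrow> (\<forall>X \<in> Obj C. central_cone C T X (FOb S X, \<iota> X))"
proof
  assume "embedding (kleisli C S) (kleisli_centre C T) (\<lambda>X. X) (kleisli_map C \<iota>)"
  then interpret E: embedding "kleisli C S" "kleisli_centre C T" "\<lambda>X. X" "kleisli_map C \<iota>" .
  show "\<forall>X \<in> Obj C. central_cone C T X (FOb S X, \<iota> X)"
  proof
    fix X assume X: "X \<in> Obj C"
    then have "(FOb S X, \<i>\<d> (FOb S X), X) \<in> Hom\<^bsub>kleisli C S\<^esub> (FOb S X) X"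
      by (simp add: S.kleisli_Hom_iff)
    from E.Fa_in_Hom [OF this] have "central_morphism C T (FOb S X, \<iota> X, X)"
      using X by (simp add: T.kleisli_centre_Hom_iff kleisli_map_def)
    then show "central_cone C T X (FOb S X, \<iota> X)"
      by (simp add: T.central_morphism_iff)
  qed
next
  assume cone: "\<forall>X \<in> Obj C. central_cone C T X (FOb S X, \<iota> X)"
  interpret K: category "kleisli C S" by (rule S.kleisli_category)
  interpret Z: category "kleisli_centre C T" by (rule T.kleisli_centre_category)
  show "embedding (kleisli C S) (kleisli_centre C T) (\<lambda>X. X) (kleisli_map C \<iota>)"
  proof
    fix X assume "X \<in> Obj (kleisli C S)"
    then show "X \<in> Obj (kleisli_centre C T)"
      and "kleisli_map C \<iota> (\<i>\<d>\<^bsub>kleisli C S\<^esub> X) = \<i>\<d>\<^bsub>kleisli_centre C T\<^esub> X"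
      by (simp_all add: kleisli_centre_def kleisli_def kleisli_map_def morphism_eta)
  next
    fix a X Y
    assume "a \<in> Hom\<^bsub>kleisli C S\<^esub> X Y"
    then obtain f where a: "a = (X, f, Y)" and types: "X \<in> Obj C" "Y \<in> Obj C"
      "f \<in> Arr C" "Dom C f = X" "Cod C f = FOb S Y"
      by (auto simp: S.kleisli_Hom_iff)
    have "central_cone C T Y (X, \<iota> Y \<cdot> f)"
      using cone types by (intro T.central_cone_Comp) (auto simp: S.Hom_iff)
    then show "kleisli_map C \<iota> a \<in> Hom\<^bsub>kleisli_centre C T\<^esub> X Y"
      using types by (simp add: T.kleisli_centre_Hom_iff T.kleisli_Hom_iff T.central_morphism_iff
          a kleisli_map_def)
  next
    fix a X Y b Z
    assume "a \<in> Hom\<^bsub>kleisli C S\<^esub> X Y" "b \<in> Hom\<^bsub>kleisli C S\<^esub> Y Z"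
    then show "kleisli_map C \<iota> (b \<cdot>\<^bsub>kleisli C S\<^esub> a)
        = kleisli_map C \<iota> b \<cdot>\<^bsub>kleisli_centre C T\<^esub> kleisli_map C \<iota> a"
      by (auto simp: S.kleisli_Hom_iff)
        (auto simp: kleisli_centre_def kleisli_def kleisli_map_def morphism_mu_left)
  next
    fix X Y
    show "inj_on (kleisli_map C \<iota>) (Hom\<^bsub>kleisli C S\<^esub> X Y)"
    proof (rule inj_onI)
      fix a b
      assume "a \<in> Hom\<^bsub>kleisli C S\<^esub> X Y" "b \<in> Hom\<^bsub>kleisli C S\<^esub> X Y"
        and eq: "kleisli_map C \<iota> a = kleisli_map C \<iota> b"
      then obtain f g where ab: "a = (X, f, Y)" "b = (X, g, Y)" and types: "Y \<in> Obj C"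
        "f \<in> Arr C" "Dom C f = X" "Cod C f = FOb S Y" "g \<in> Arr C" "Dom C g = X" "Cod C g = FOb S Y"
        by (auto simp: S.kleisli_Hom_iff)
      \<comment> \<open>Faithfulness is where monicity of the components of \<open>\<iota>\<close>
        enters.\<close>
      have "f = g"
        by (rule S.monicD [of "\<iota> Y"]) (use eq ab types monic in \<open>auto simp: kleisli_map_def\<close>)
      then show "a = b"
        using ab by simp
    qed
  qed simp
qed

end

section \<open>Factorisation through the centre\<close>

lemma central_cones_iff_factor_through_centre:
  fixes C (structure)
  assumes sub: "strong_submonad C S T \<iota>" and monic: "\<forall>X \<in> Obj C. monic C (\<iota> X)"
    and centre: "is_centre C T Z \<zeta>"
  shows "(\<forall>X \<in> Obj C. central_cone C T X (FOb S X, \<iota> X)) \<longleftrightarrow>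
    commutative_monad C S \<and> (\<exists>j. strong_submonad C S Z j \<and> (\<forall>X \<in> Obj C. \<zeta> X \<cdot> j X = \<iota> X))"
proof -
  interpret I: strong_monad_morphism C S T \<iota>
    using sub by (simp add: strong_submonad_def)
  interpret Z: strong_monad_morphism C Z T \<zeta>
    using centre by (simp add: is_centre_def strong_submonad_def)
  have terminal: "terminal_central_cone C T X (FOb Z X, \<zeta> X)" if "X \<in> Obj C" for X
    using centre that by (simp add: is_centre_def)
  then have \<zeta>_cone: "central_cone C T X (FOb Z X, \<zeta> X)" if "X \<in> Obj C" for X
    using that by (simp add: terminal_central_cone_def)
  show ?thesis
  proof
    assume "commutative_monad C S
      \<and> (\<exists>j. strong_submonad C S Z j \<and> (\<forall>X \<in> Obj C. \<zeta> X \<cdot> j X = \<iota> X))"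
    then obtain j where j: "strong_submonad C S Z j" "\<forall>X \<in> Obj C. \<zeta> X \<cdot> j X = \<iota> X"
      by blast
    then interpret J: strong_monad_morphism C S Z j
      by (simp add: strong_submonad_def)
    show "\<forall>X \<in> Obj C. central_cone C T X (FOb S X, \<iota> X)"
      \<comment> \<open>Each \<open>\<iota> X\<close> is the central cone \<open>\<zeta> X\<close>
        precomposed with \<open>j X\<close>.\<close>
      using I.T.central_cone_Comp [OF \<zeta>_cone _ J.morphism_in_Hom] j(2) by metis
  next
    assume cone: "\<forall>X \<in> Obj C. central_cone C T X (FOb S X, \<iota> X)"
    then have "\<forall>X \<in> Obj C. \<exists>\<phi>. \<phi> \<in> Hom (FOb S X) (FOb Z X) \<and> \<zeta> X \<cdot> \<phi> = \<iota> X"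
      using terminal unfolding terminal_central_cone_def by blast
    then obtain j where j_Hom: "\<And>X. X \<in> Obj C \<Longrightarrow> j X \<in> Hom (FOb S X) (FOb Z X)"
      and \<zeta>_j: "\<And>X. X \<in> Obj C \<Longrightarrow> \<zeta> X \<cdot> j X = \<iota> X"
      by metis
    note j_typing [simp] = j_Hom [THEN I.S.in_HomD(1)] j_Hom [THEN I.S.in_HomD(2)]
      j_Hom [THEN I.S.in_HomD(3)]
    have \<zeta>_monic: "monic C (\<zeta> X)" if "X \<in> Obj C" for X
      using I.T.terminal_central_cone_monic [OF terminal] that by blast
    have \<zeta>_j_left: "\<zeta> X \<cdot> j X \<cdot> h = \<iota> X \<cdot> h"
      if "X \<in> Obj C" "h \<in> Arr C" "Cod C h = FOb S X" for X h
      using I.S.Comp_cong_left [OF \<zeta>_j] that by simp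
    have "strong_monad_morphism C S Z j"
    proof
      fix X assume X: "X \<in> Obj C"
      show "j X \<in> Hom (FOb S X) (FOb Z X)"
        using j_Hom X .
      \<comment> \<open>Each law for \<open>j\<close> is checked after composing with the monic
        \<open>\<zeta>\<close>, where it reduces to the laws of \<open>\<iota>\<close> and
        \<open>\<zeta>\<close> as morphisms into \<open>T\<close>.\<close>
      have "\<zeta> X \<cdot> j X \<cdot> eta S X = \<zeta> X \<cdot> eta Z X"
        using X by (simp add: \<zeta>_j_left I.morphism_eta Z.morphism_eta)
      then show "j X \<cdot> eta S X = eta Z X"
        by (rule I.S.monicD [OF \<zeta>_monic, rotated]) (use X in auto)
      \<comment> \<open>On the \<open>Z\<close> side, the multiplication law of
        \<open>\<zeta>\<close> and naturality put \<open>\<zeta> X\<close> and \<open>j X\<close>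
        under \<open>T\<close>; the factorisation of \<open>\<iota> X\<close> is therefore used in
        its image under \<open>FAr T\<close>.\<close>
      have "FAr T (\<zeta> X) \<cdot> FAr T (j X) \<cdot> \<iota> (FOb S X) = FAr T (\<iota> X) \<cdot> \<iota> (FOb S X)"
        by (rule I.S.Comp_cong_left) (use X \<zeta>_j [OF X] I.T.FAr_Comp [of "j X" "\<zeta> X"] in auto)
      then have "\<zeta> X \<cdot> j X \<cdot> mu S X = \<zeta> X \<cdot> mu Z X \<cdot> FAr Z (j X) \<cdot> j (FOb S X)"
        using X by (simp add: \<zeta>_j_left \<zeta>_j I.morphism_mu Z.morphism_mu_left)
      then show "j X \<cdot> mu S X = mu Z X \<cdot> FAr Z (j X) \<cdot> j (FOb S X)"
        by (rule I.S.monicD [OF \<zeta>_monic, rotated]) (use X in auto)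
      fix Y assume Y: "Y \<in> Obj C"
      have "\<zeta> (X \<boxtimes> Y) \<cdot> j (X \<boxtimes> Y) \<cdot> tau S X Y = \<zeta> (X \<boxtimes> Y) \<cdot> tau Z X Y \<cdot> (\<i>\<d> X \<otimes> j Y)"
        using X Y by (simp add: \<zeta>_j_left \<zeta>_j I.morphism_tau Z.morphism_tau_left)
      then show "j (X \<boxtimes> Y) \<cdot> tau S X Y = tau Z X Y \<cdot> (\<i>\<d> X \<otimes> j Y)"
        by (rule I.S.monicD [OF \<zeta>_monic, rotated]) (use X Y in auto)
    next
      fix f X Y assume "f \<in> Hom X Y"
      note f = I.S.in_HomD [OF this]
      have "\<zeta> Y \<cdot> j Y \<cdot> FAr S f = \<zeta> Y \<cdot> FAr Z f \<cdot> j X"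
        using f by (simp add: \<zeta>_j_left \<zeta>_j)
      then show "j Y \<cdot> FAr S f = FAr Z f \<cdot> j X"
        by (rule I.S.monicD [OF \<zeta>_monic, rotated]) (use f in auto)
    qed
    \<comment> \<open>If \<open>j\<close> equalises \<open>\<phi>\<close> and \<open>\<psi>\<close>,
      then so does \<open>\<iota>\<close>, which factors through \<open>j\<close>; and
      \<open>\<iota>\<close> is a monomorphism of strong monads.\<close>
    moreover have "\<forall>X \<in> Obj C. \<phi> X = \<psi> X"
      if \<phi>: "strong_monad_morphism C R S \<phi>" and \<psi>: "strong_monad_morphism C R S \<psi>"
        and eq: "\<forall>X \<in> Obj C. j X \<cdot> \<phi> X = j X \<cdot> \<psi> X" for R \<phi> \<psi>
    proof -
      interpret P: strong_monad_morphism C R S \<phi> by (rule \<phi>)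
      interpret Q: strong_monad_morphism C R S \<psi> by (rule \<psi>)
      have "\<iota> X \<cdot> \<phi> X = \<iota> X \<cdot> \<psi> X" if X: "X \<in> Obj C" for X
        using eq X \<zeta>_j_left [of X "\<phi> X"] \<zeta>_j_left [of X "\<psi> X"] by simp
      then show ?thesis
        using sub \<phi> \<psi> unfolding strong_submonad_def by blast
    qed
    ultimately show "commutative_monad C S
        \<and> (\<exists>j. strong_submonad C S Z j \<and> (\<forall>X \<in> Obj C. \<zeta> X \<cdot> j X = \<iota> X))"
      using I.commutative_if_central_cones [OF monic cone] \<zeta>_j unfolding strong_submonad_def by blast
  qed
qed

theorem mainTheorem10:
  fixes C :: "('o, 'm) smcat"
    and T S :: "('o, 'm) strong_monad"
    and \<iota> :: "'o \<Rightarrow> 'm"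
  assumes "symmetric_monoidal_category C"
    and "strong_monad C T"
    and "strong_submonad C S T \<iota>"
    and "\<forall>X \<in> Obj C. monic C (\<iota> X)"
  defines "cond1 \<equiv> \<forall>X \<in> Obj C. central_cone C T X (FOb S X, \<iota> X)"
    and "cond2 \<equiv> embedding (kleisli C S) (kleisli_centre C T) (\<lambda>X. X) (kleisli_map C \<iota>)"
  shows "(cond1 \<longleftrightarrow> cond2)
    \<and> (cond1 \<longrightarrow> commutative_monad C S)
    \<and> (\<forall>Z \<zeta>. centralisable C T \<longrightarrow> is_centre C T Z \<zeta> \<longrightarrow>
         (cond1 \<longleftrightarrow> commutative_monad C S \<and>
            (\<exists>j. strong_submonad C S Z j \<and> (\<forall>X \<in> Obj C. \<zeta> X \<cdot>\<^bsub>C\<^esub> j X = \<iota> X))))"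
proof -
  interpret strong_monad_morphism C S T \<iota>
    using assms(3) by (simp add: strong_submonad_def)
  show ?thesis
    using embedding_iff_central_cones [OF assms(4)] commutative_if_central_cones [OF assms(4)]
      central_cones_iff_factor_through_centre [OF assms(3,4)]
    unfolding cond1_def cond2_def by blast
qed

end
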